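(* Let $q$ be a prime power, $v\ge 1$, $\Delta>1$ an integer, and let $\mathcal{P}$ be the set of points of $\mathrm{PG}(v-1,\mathbb{F}_q)$. Let $\mathcal{C}\subseteq\mathcal{P}$ with $\mathcal{C}\neq\emptyset$ and $\mathcal{C}\ne\mathcal{P}$ be weakly $\Delta$-divisible, and let $n=|\mathcal{C}|$. Let $G\in\mathbb{F}_q^{v\times n}$ be a matrix whose columns are nonzero representatives of the $n$ points of $\mathcal{C}$ (one column per point), and let $C$ be the linear code of length $n$ over $\mathbb{F}_q$ spanned by the rows of $G$. Then: (i) $\mathcal{C}$ is strongly $\Delta$-divisible; (ii) every nonzero codeword of $C$ has Hamming weight divisible by $\Delta$; (iii) $\Delta$ divides $q^{v-2}$.
   Context: Points of $\mathrm{PG}(v-1,\mathbb{F}_q)$ are the $1$-dimensional subspaces of $\mathbb{F}_q^v$, hyperplanes are the $(v-1)$-dimensional subspaces; a point lies in a hyperplane $H$ if it is contained in $H$, and $\mathcal{C}\cap H$ denotes the set of points of $\mathcal{C}$ contained in $H$. For an integer $\Delta>1$, a point set $\mathcal{C}$ is weakly $\Delta$-divisible if there is an integer $u$ with $|\mathcal{C}\cap H|\equiv u\pmod{\Delta}$ for every hyperplane $H$; it is (strongly) $\Delta$-divisible if moreover this holds with $u=|\mathcal{C}|$, i.e. $|\mathcal{C}\cap H|\equiv|\mathcal{C}|\pmod\Delta$ for every hyperplane $H$. *)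

theory Defs
  imports "HOL-Analysis.Analysis" "HOL-Number_Theory.Cong"
begin

text \<open>
  The field with \<open>q\<close> elements is a type \<open>'a\<close> of sort \<open>{finite, field}\<close>, with
  \<open>q = CARD('a)\<close>, and the ambient space of dimension \<open>v = CARD('v) \<ge> 1\<close> is
  \<^typ>\<open>'a ^ 'v\<close>. Subspaces, dimension and span are those of the scalar multiplication
  \<open>*s\<close> over \<open>'a\<close> (prefix \<open>vec\<close>), not those of the real vector space structure.
\<close>

definition pg_points :: "('a::{finite,field} ^ 'v) set set" where
  "pg_points = {P. vec.subspace P \<and> vec.dim P = 1}"

definition pg_hyperplanes :: "('a::{finite,field} ^ 'v) set set" where
  "pg_hyperplanes = {H. vec.subspace H \<and> vec.dim H = CARD('v) - 1}"

text \<open>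
  Points are themselves sets of vectors, so the points of \<open>\<C>\<close> in \<open>H\<close> are those contained in
  \<open>H\<close> as subspaces; this is not the set intersection of \<open>\<C>\<close> and \<open>H\<close>.
\<close>

definition points_in ::
  "('a::{finite,field} ^ 'v) set set \<Rightarrow> ('a ^ 'v) set \<Rightarrow> ('a ^ 'v) set set" where
  "points_in \<C> H = {P \<in> \<C>. P \<subseteq> H}"

definition weakly_divisible :: "nat \<Rightarrow> ('a::{finite,field} ^ 'v) set set \<Rightarrow> bool" where
  "weakly_divisible \<Delta> \<C> \<longleftrightarrow>
    (\<exists>u::int. \<forall>H\<in>pg_hyperplanes. [int (card (points_in \<C> H)) = u] (mod int \<Delta>))"

definition strongly_divisible :: "nat \<Rightarrow> ('a::{finite,field} ^ 'v) set set \<Rightarrow> bool" where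
  "strongly_divisible \<Delta> \<C> \<longleftrightarrow>
    (\<forall>H\<in>pg_hyperplanes. [int (card (points_in \<C> H)) = int (card \<C>)] (mod int \<Delta>))"

text \<open>
  The columns of \<open>G\<close>, indexed by the type \<open>'n\<close>, are nonzero representatives of the points of
  \<open>\<C>\<close>, one for each point; in particular \<open>CARD('n) = card \<C>\<close>.
\<close>

definition represents_points ::
  "'a ^ 'n ^ 'v \<Rightarrow> ('a::{finite,field} ^ 'v) set set \<Rightarrow> bool" where
  "represents_points G \<C> \<longleftrightarrow>
    (\<forall>j. column j G \<noteq> 0) \<and> bij_betw (\<lambda>j. vec.span {column j G}) UNIV \<C>"

definition row_code :: "'a::{finite,field} ^ 'n ^ 'v \<Rightarrow> ('a ^ 'n) set" where
  "row_code G = vec.span (rows G)"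

definition hamming_weight :: "'a::zero ^ 'n \<Rightarrow> nat" where
  "hamming_weight c = card {j. c $ j \<noteq> 0}"

end

theory Submission
  imports Defs
begin

text \<open>
  Write \<open>w\<^sup>\<perp>\<close> for the hyperplane of a vector \<open>w \<noteq> 0\<close>. Summing over vectors \<open>w\<close> instead of
  hyperplanes avoids dividing by \<open>q - 1\<close>, which need not be invertible modulo \<open>\<Delta>\<close>.

  Choose points \<open>\<langle>p\<rangle> \<in> \<C>\<close> and \<open>\<langle>r\<rangle> \<notin> \<C>\<close>. The affine spaces \<open>{w. w \<cdot> p = 0 \<and> w \<cdot> r = 1}\<close> and
  \<open>{w. w \<cdot> p = 1 \<and> w \<cdot> r = 0}\<close> both have \<open>q\<^bsup>v-2\<^esup>\<close> elements, and a point of \<open>\<C>\<close> other than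
  \<open>\<langle>p\<rangle>\<close> is orthogonal to equally many vectors of either. So the sums of \<open>|\<C> \<inter> w\<^sup>\<perp>|\<close> over the two
  spaces differ by exactly the contribution \<open>q\<^bsup>v-2\<^esup>\<close> of \<open>\<langle>p\<rangle>\<close>, whereas both are congruent to
  \<open>u q\<^bsup>v-2\<^esup>\<close>; this gives (iii). Summing over all \<open>w\<close>, where \<open>w = 0\<close> contributes \<open>n\<close>, gives
  \<open>n + (q\<^sup>v - 1) u \<equiv> n q\<^bsup>v-1\<^esup>\<close>, so \<open>n \<equiv> u\<close> by (iii); this is (i). The zero positions of a codeword
  are the points of \<open>\<C>\<close> in some \<open>w\<^sup>\<perp>\<close>, whence (ii).
\<close>

section \<open>Bilinear form, orthogonal complements and hyperplanes\<close>

definition dot :: "'a::field ^ 'v \<Rightarrow> 'a ^ 'v \<Rightarrow> 'a" where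
  "dot w x = (\<Sum>i\<in>UNIV. w $ i * x $ i)"

definition orth :: "'a::field ^ 'v \<Rightarrow> ('a ^ 'v) set" where
  "orth w = {x. dot w x = 0}"

lemma dot_add_left: "dot (a + b) x = dot a x + dot b x"
  by (simp add: dot_def algebra_simps sum.distrib)

lemma dot_diff_left: "dot (a - b) x = dot a x - dot b x"
  by (simp add: dot_def algebra_simps sum_subtractf)

lemma dot_add_right: "dot w (x + y) = dot w x + dot w y"
  by (simp add: dot_def algebra_simps sum.distrib)

lemma dot_scale_left: "dot (k *s w) x = k * dot w x"
  by (simp add: dot_def sum_distrib_left algebra_simps)

lemma dot_scale_right: "dot w (k *s x) = k * dot w x"
  by (simp add: dot_def sum_distrib_left algebra_simps)

lemma dot_zero_left [simp]: "dot 0 x = 0"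
  and dot_zero_right [simp]: "dot w 0 = 0"
  by (simp_all add: dot_def)

lemma dot_axis_left [simp]: "dot (axis i 1) x = x $ i"
  by (simp add: dot_def axis_def if_distrib [of "\<lambda>z. z * _"] cong: if_cong)

lemma dot_axis_right [simp]: "dot w (axis i 1) = w $ i"
  by (simp add: dot_def axis_def if_distrib [of "\<lambda>z. _ * z"] cong: if_cong)

lemma subspace_orth: "vec.subspace (orth w)"
  by (simp add: vec.subspace_def orth_def dot_add_right dot_scale_right)

lemma span_singleton_subset_orth_iff: "vec.span {x} \<subseteq> orth w \<longleftrightarrow> dot w x = 0"
proof
  assume "vec.span {x} \<subseteq> orth w"
  then show "dot w x = 0" using vec.span_base [of x "{x}"] by (auto simp: orth_def)
next
  assume "dot w x = 0"
  then show "vec.span {x} \<subseteq> orth w"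
    by (intro vec.span_minimal subspace_orth) (simp add: orth_def)
qed

text \<open>A linear map can be prescribed freely on an independent set. The required values are
  placed in a single coordinate, and the matching row of the map's matrix is the vector
  sought.\<close>

lemma ex_dot_eq_on_independent:
  fixes S :: "('a::field ^ 'v) set"
  assumes "vec.independent S"
  obtains w where "\<And>x. x \<in> S \<Longrightarrow> dot w x = c x"
proof -
  \<comment> \<open>Any coordinate serves; index types are nonempty.\<close>
  fix i :: 'v
  obtain g :: "'a ^ 'v \<Rightarrow> 'a ^ 'v" where lin: "Vector_Spaces.linear (*s) (*s) g"
    and g: "\<forall>x\<in>S. g x = axis i (c x)"
    using vec.linear_independent_extend [OF assms, of "\<lambda>x. axis i (c x)"] by blast
  have "dot (matrix g $ i) x = c x" if "x \<in> S" for x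
  proof -
    have "dot (matrix g $ i) x = (matrix g *v x) $ i"
      by (simp add: dot_def matrix_vector_mult_def)
    also have "\<dots> = c x"
      using g that by (simp add: matrix_works [OF lin] axis_def)
    finally show ?thesis .
  qed
  then show ?thesis by (rule that)
qed

text \<open>The solution sets for the various right-hand sides partition the space and are
  translates of one another, so they have equal size. The product form avoids a truncated
  subtraction in the exponent.\<close>

lemma card_dot_eq_on_independent:
  fixes S :: "('a::{finite,field} ^ 'v) set"
  assumes indep: "vec.independent S"
  shows "card {w. \<forall>x\<in>S. dot w x = c x} * CARD('a) ^ card S = CARD('a) ^ CARD('v)"
proof -
  define F where "F c = {w. \<forall>x\<in>S. dot w x = c x}" for c
  have card_F: "card (F d) = card (F c)" for d
  proof -
    \<comment> \<open>Translation by a vector attaining the difference of the two prescriptions maps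
      \<open>F d\<close> onto \<open>F c\<close>.\<close>
    obtain w0 where w0: "\<And>x. x \<in> S \<Longrightarrow> dot w0 x = c x - d x"
      using ex_dot_eq_on_independent [OF indep, of "\<lambda>x. c x - d x"] by blast
    have "bij_betw (\<lambda>w. w + w0) (F d) (F c)"
      by (rule bij_betw_byWitness [where f' = "\<lambda>w. w - w0"])
        (auto simp: F_def dot_add_left dot_diff_left w0)
    then show ?thesis by (rule bij_betw_same_card)
  qed
  have "(UNIV :: ('a ^ 'v) set) = (\<Union>d \<in> S \<rightarrow>\<^sub>E UNIV. F d)"
  proof (rule equalityI; rule subsetI)
    fix w :: "'a ^ 'v"
    show "w \<in> (\<Union>d \<in> S \<rightarrow>\<^sub>E UNIV. F d)"
      by (rule UN_I [where a = "restrict (dot w) S"]) (simp_all add: F_def)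
  qed simp
  then have "CARD('a) ^ CARD('v) = card (\<Union>d \<in> S \<rightarrow>\<^sub>E UNIV. F d)"
    by (rule trans [OF CARD_vec [symmetric] arg_cong [where f = card]])
  also have "\<dots> = (\<Sum>d \<in> S \<rightarrow>\<^sub>E UNIV. card (F d))"
  proof (rule card_UN_disjoint)
    have "d = e" if "d \<in> S \<rightarrow>\<^sub>E UNIV" "e \<in> S \<rightarrow>\<^sub>E UNIV" "w \<in> F d" "w \<in> F e"
      for d e :: "'a ^ 'v \<Rightarrow> 'a" and w
      using that by (intro PiE_ext) (auto simp: F_def)
    then show "\<forall>d\<in>S \<rightarrow>\<^sub>E UNIV. \<forall>e\<in>S \<rightarrow>\<^sub>E UNIV. d \<noteq> e \<longrightarrow> F d \<inter> F e = {}"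
      by blast
  qed (simp_all add: finite_PiE)
  also have "\<dots> = (\<Sum>d \<in> S \<rightarrow>\<^sub>E (UNIV :: 'a set). card (F c))"
    by (rule sum.cong [OF refl card_F])
  also have "\<dots> = card (F c) * CARD('a) ^ card S"
    by (simp add: card_PiE)
  finally show ?thesis by (simp add: F_def)
qed

text \<open>A vector \<open>y\<close> with \<open>dot w y\<close> nonzero lies outside
  \<open>orth w\<close> and, together with it, spans the whole space; hence the dimension drops by
  exactly one.\<close>

lemma orth_in_pg_hyperplanes:
  fixes w :: "'a::{finite,field} ^ 'v"
  assumes "w \<noteq> 0"
  shows "orth w \<in> pg_hyperplanes"
proof -
  obtain i where i: "w $ i \<noteq> 0"
    using assms by (metis vec_eq_iff zero_index)
  define y where "y = axis i (1::'a)"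
  have y: "dot w y \<noteq> 0" using i by (simp add: y_def)
  have "z \<in> vec.span (insert y (orth w))" for z
  proof -
    \<comment> \<open>The coefficient is chosen to cancel \<open>dot w z\<close>.\<close>
    have "z + (- (dot w z / dot w y)) *s y \<in> orth w"
      unfolding orth_def mem_Collect_eq dot_add_right dot_scale_right using y by simp
    then have "z - (dot w z / dot w y) *s y \<in> orth w" by simp
    then show ?thesis
      using vec.span_base vec.span_breakdown_eq by blast
  qed
  then have "vec.span (insert y (orth w)) = UNIV" by blast
  then have "vec.dim (insert y (orth w)) = CARD('v)"
    by (metis vec.dim_span vec_dim_card)
  moreover have "y \<notin> vec.span (orth w)"
    unfolding vec.span_eq_iff [THEN iffD2, OF subspace_orth] using y by (simp add: orth_def)
  ultimately have "vec.dim (orth w) = CARD('v) - 1"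
    by (simp add: vec.dim_insert)
  then show ?thesis by (simp add: pg_hyperplanes_def subspace_orth)
qed

text \<open>A basis of \<open>H\<close> is enlarged by some \<open>y\<close> outside
  \<open>H\<close>. A vector \<open>w\<close> vanishing on the basis but not at \<open>y\<close>
  satisfies \<open>H \<subseteq> orth w\<close>, and equal dimensions force equality.\<close>

lemma pg_hyperplanesE:
  fixes H :: "('a::{finite,field} ^ 'v) set"
  assumes "H \<in> pg_hyperplanes"
  obtains w where "w \<noteq> 0" "H = orth w"
proof -
  have H: "vec.subspace H" "vec.dim H = CARD('v) - 1"
    using assms by (auto simp: pg_hyperplanes_def)
  obtain B where B: "B \<subseteq> H" "vec.independent B" "H \<subseteq> vec.span B"
    by (rule vec.basis_exists [of H]) blast
  have span_B: "vec.span B = H"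
    using B H(1) by (simp add: vec.span_minimal subset_antisym)
  have "H \<noteq> UNIV"
  proof
    assume "H = UNIV"
    then have "vec.dim H = CARD('v)" by (simp only: vec_dim_card)
    \<comment> \<open>Positivity of \<open>CARD('v)\<close> makes the truncated difference strictly
      smaller than the full dimension.\<close>
    with H(2) zero_less_card_finite [where 'a = 'v] show False by linarith
  qed
  then obtain y where y: "y \<notin> H" by blast
  have "vec.independent (insert y B)"
    using B(2) y span_B by (simp add: vec.independent_insert)
  then obtain w where w: "\<And>x. x \<in> insert y B \<Longrightarrow> dot w x = (if x = y then 1 else 0)"
    by (rule ex_dot_eq_on_independent [where c = "\<lambda>x. if x = y then 1 else 0"]) blast
  have nz: "w \<noteq> 0" using w [of y] by auto
  have "B \<subseteq> orth w" using w y B(1) by (auto simp: orth_def)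
  then have sub: "H \<subseteq> orth w"
    using span_B subspace_orth vec.span_minimal by blast
  have "vec.dim (orth w) = CARD('v) - 1"
    using orth_in_pg_hyperplanes [OF nz] by (simp add: pg_hyperplanes_def)
  then have "H = orth w"
    by (intro vec.subspace_dim_equal H(1) subspace_orth sub) (simp add: H(2))
  with nz show ?thesis by (rule that)
qed

section \<open>Points and their representatives\<close>

lemma span_singleton_in_pg_points:
  "x \<noteq> 0 \<Longrightarrow> vec.span {x} \<in> pg_points"
  by (simp add: pg_points_def vec.dim_insert)

lemma pg_point_eqI:
  assumes "P \<in> pg_points" "x \<in> P" "x \<noteq> 0"
  shows "P = vec.span {x}"
proof (rule sym, rule vec.subspace_dim_equal)
  show "vec.span {x} \<subseteq> P"
    using assms by (intro vec.span_minimal) (auto simp: pg_points_def)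
  show "vec.dim P \<le> vec.dim (vec.span {x})"
    using assms span_singleton_in_pg_points [OF assms(3)] by (simp add: pg_points_def)
qed (use assms in \<open>auto simp: pg_points_def\<close>)

lemma pg_pointsE:
  assumes "P \<in> pg_points"
  obtains x where "x \<noteq> 0" "P = vec.span {x}"
proof -
  have "\<not> P \<subseteq> {0}"
    using assms vec.dim_eq_0 [of P] by (auto simp: pg_points_def)
  then obtain x where "x \<in> P" "x \<noteq> 0" by blast
  with assms that show ?thesis by (metis pg_point_eqI)
qed

lemma independent_pair_of_points:
  fixes x y :: "'a::{finite,field} ^ 'v"
  assumes "x \<noteq> 0" "y \<noteq> 0" "vec.span {x} \<noteq> vec.span {y}"
  shows "x \<noteq> y" "vec.independent {x, y}"
proof -
  show "x \<noteq> y" using assms by auto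
  have "x \<notin> vec.span {y}"
    using assms pg_point_eqI [OF span_singleton_in_pg_points, of y x] by auto
  then show "vec.independent {x, y}"
    using assms \<open>x \<noteq> y\<close> by (simp add: vec.independent_insert)
qed

section \<open>Double counting of orthogonal pairs of vectors and points\<close>

lemma sum_card_points_in_orth:
  fixes \<C> :: "('a::{finite,field} ^ 'v) set set" and A :: "('a ^ 'v) set"
  shows "(\<Sum>w\<in>A. card (points_in \<C> (orth w))) = (\<Sum>P\<in>\<C>. card {w\<in>A. P \<subseteq> orth w})"
proof -
  have "(\<Sum>w\<in>A. card (points_in \<C> (orth w))) = (\<Sum>w\<in>A. \<Sum>P\<in>\<C>. if P \<subseteq> orth w then 1 else 0)"
    by (simp add: points_in_def sum.If_cases Int_def)
  also have "\<dots> = (\<Sum>P\<in>\<C>. \<Sum>w\<in>A. if P \<subseteq> orth w then 1 else 0)"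
    by (rule sum.swap)
  also have "\<dots> = (\<Sum>P\<in>\<C>. card {w\<in>A. P \<subseteq> orth w})"
    by (simp add: sum.If_cases Int_def)
  finally show ?thesis .
qed

text \<open>The zero vector is excluded because its orthogonal complement is the whole space, about
  which weak divisibility says nothing.\<close>

lemma cong_sum_card_points_in_orth:
  fixes \<C> :: "('a::{finite,field} ^ 'v) set set"
  assumes u: "\<forall>H\<in>pg_hyperplanes. [int (card (points_in \<C> H)) = u] (mod m)"
    and "0 \<notin> A"
  shows "[(\<Sum>w\<in>A. int (card (points_in \<C> (orth w)))) = int (card A) * u] (mod m)"
proof -
  have "[(\<Sum>w\<in>A. int (card (points_in \<C> (orth w)))) = (\<Sum>w\<in>A. u)] (mod m)"
  proof (rule cong_sum)
    fix w assume "w \<in> A"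
    with \<open>0 \<notin> A\<close> have "orth w \<in> pg_hyperplanes" by (intro orth_in_pg_hyperplanes) auto
    with u show "[int (card (points_in \<C> (orth w))) = u] (mod m)" by blast
  qed
  then show ?thesis by simp
qed

text \<open>If \<open>X\<close> lies on the line through the two given points, both sets are empty.
  Otherwise the three representatives are independent, and the number of solutions does not depend
  on the prescribed values.\<close>

lemma card_orth_point_swap:
  fixes p r :: "'a::{finite,field} ^ 'v"
  assumes X: "X \<in> pg_points" "X \<noteq> vec.span {p}" "X \<noteq> vec.span {r}"
    and nz: "p \<noteq> 0" "r \<noteq> 0" and ne: "vec.span {p} \<noteq> vec.span {r}"
  shows "card {w. dot w p = 0 \<and> dot w r = 1 \<and> X \<subseteq> orth w}
       = card {w. dot w p = 1 \<and> dot w r = 0 \<and> X \<subseteq> orth w}"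
proof -
  obtain x where x: "x \<noteq> 0" "X = vec.span {x}" using X(1) by (rule pg_pointsE)
  have pr: "p \<noteq> r" "vec.independent {p, r}"
    using independent_pair_of_points [OF nz ne] by auto
  show ?thesis
  proof (cases "x \<in> vec.span {p, r}")
    case True
    then obtain a where "x - a *s p \<in> vec.span {r}"
      by (auto simp: vec.span_breakdown_eq)
    then obtain b where "x - a *s p = b *s r"
      by (auto simp: vec.span_singleton)
    then have ab: "x = a *s p + b *s r"
      by (metis add.commute diff_add_cancel)
    \<comment> \<open>If \<open>x\<close> were a multiple of \<open>p\<close> or \<open>r\<close>,
      then \<open>X\<close> would be one of the two excluded points. Hence both coefficients are
      nonzero.\<close>
    have no_mult: "x \<noteq> k *s p" "x \<noteq> k *s r" for k
      using X x pg_point_eqI [OF span_singleton_in_pg_points] nz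
      by (metis insertI1 vec.span_base vec.span_scale)+
    have a: "a \<noteq> 0" and b: "b \<noteq> 0"
      using no_mult [of a] no_mult [of b] ab by auto
    \<comment> \<open>Here \<open>dot w x\<close> equals \<open>b\<close> under the first pair of
      conditions and \<open>a\<close> under the second, so it cannot vanish.\<close>
    have "{w. dot w p = 0 \<and> dot w r = 1 \<and> X \<subseteq> orth w} = {}"
      "{w. dot w p = 1 \<and> dot w r = 0 \<and> X \<subseteq> orth w} = {}"
      using a b unfolding x(2) span_singleton_subset_orth_iff ab
      by (auto simp: dot_add_right dot_scale_right)
    then show ?thesis by (simp only:)
  next
    case False
    then have xpr: "x \<noteq> p" "x \<noteq> r" "vec.independent {x, p, r}"
      using pr vec.span_base [of _ "{p, r}"] by (auto simp: vec.independent_insert)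
    have "card {w. \<forall>y\<in>{x, p, r}. dot w y = (if y = r then 1 else 0)} * CARD('a) ^ card {x, p, r}
        = card {w. \<forall>y\<in>{x, p, r}. dot w y = (if y = p then 1 else 0)} * CARD('a) ^ card {x, p, r}"
      by (simp only: card_dot_eq_on_independent [OF xpr(3)])
    moreover have "{w. \<forall>y\<in>{x, p, r}. dot w y = (if y = r then 1 else 0)}
        = {w. dot w p = 0 \<and> dot w r = 1 \<and> X \<subseteq> orth w}"
      "{w. \<forall>y\<in>{x, p, r}. dot w y = (if y = p then 1 else 0)}
        = {w. dot w p = 1 \<and> dot w r = 0 \<and> X \<subseteq> orth w}"
      using xpr pr by (auto simp: x(2) span_singleton_subset_orth_iff)
    ultimately show ?thesis by simp
  qed
qed

lemma card_dot_pair: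
  fixes p r :: "'a::{finite,field} ^ 'v"
  assumes "p \<noteq> r" "vec.independent {p, r}"
  shows "card {w. dot w p = c \<and> dot w r = d} = CARD('a) ^ (CARD('v) - 2)"
proof -
  have q: "1 < CARD('a)"
    using card_mono [of UNIV "{0, 1 :: 'a}"] by simp
  have count: "card {w. dot w p = c \<and> dot w r = d} * CARD('a) ^ 2 = CARD('a) ^ CARD('v)"
    using card_dot_eq_on_independent [OF assms(2), of "\<lambda>x. if x = p then c else d"] assms(1)
    by (simp add: power2_eq_square)
  \<comment> \<open>The count itself yields \<open>2 \<le> CARD('v)\<close>, so the exponent
    \<open>CARD('v) - 2\<close> is a genuine difference.\<close>
  have "CARD('a) ^ 2 dvd CARD('a) ^ CARD('v)"
    unfolding count [symmetric] by simp
  then have v: "2 \<le> CARD('v)"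
    using q by (simp add: power_dvd_imp_le)
  have "CARD('a) ^ CARD('v) = CARD('a) ^ (CARD('v) - 2) * CARD('a) ^ 2"
    using v by (simp only: le_add_diff_inverse2 flip: power_add)
  with count q show "card {w. dot w p = c \<and> dot w r = d} = CARD('a) ^ (CARD('v) - 2)"
    by simp
qed

section \<open>Divisibility of the power of q, then strong divisibility\<close>

lemma weakly_divisible_dvd_power:
  fixes \<C> :: "('a::{finite,field} ^ 'v) set set"
  assumes sub: "\<C> \<subseteq> pg_points" and "\<C> \<noteq> {}" "\<C> \<noteq> pg_points"
    and "weakly_divisible \<Delta> \<C>"
  shows "\<Delta> dvd CARD('a) ^ (CARD('v) - 2)"
proof -
  obtain u where u: "\<forall>H\<in>pg_hyperplanes. [int (card (points_in \<C> H)) = u] (mod int \<Delta>)"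
    using assms(4) by (auto simp: weakly_divisible_def)
  obtain P R where P: "P \<in> \<C>" and R: "R \<in> pg_points" "R \<notin> \<C>"
    using assms by blast
  obtain p where p: "p \<noteq> 0" "P = vec.span {p}" using P sub by (blast elim: pg_pointsE)
  obtain r where r: "r \<noteq> 0" "R = vec.span {r}" using R by (blast elim: pg_pointsE)
  have ne: "vec.span {p} \<noteq> vec.span {r}" using P R p r by auto
  note pr = independent_pair_of_points [OF p(1) r(1) ne]
  define M where "M = CARD('a) ^ (CARD('v) - 2)"
  define A where "A = {w. dot w p = 0 \<and> dot w r = 1}"
  define B where "B = {w. dot w p = 1 \<and> dot w r = 0}"
  have card_A: "card A = M" and card_B: "card B = M"
    by (simp_all add: A_def B_def M_def card_dot_pair [OF pr])
  have "{w\<in>A. P \<subseteq> orth w} = A" "{w\<in>B. P \<subseteq> orth w} = {}"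
    by (auto simp: A_def B_def p(2) span_singleton_subset_orth_iff)
  then have at_P: "card {w\<in>A. P \<subseteq> orth w} = card {w\<in>B. P \<subseteq> orth w} + M"
    by (simp add: card_A)
  have off_P: "card {w\<in>A. X \<subseteq> orth w} = card {w\<in>B. X \<subseteq> orth w}" if "X \<in> \<C> - {P}" for X
    using card_orth_point_swap [OF _ _ _ p(1) r(1) ne, of X] that sub R p(2) r(2)
    by (auto simp: A_def B_def)
  have "(\<Sum>w\<in>A. card (points_in \<C> (orth w))) = (\<Sum>w\<in>B. card (points_in \<C> (orth w))) + M"
    unfolding sum_card_points_in_orth using P
    by (simp add: sum.remove [of \<C> P] at_P off_P)
  then have "(\<Sum>w\<in>A. int (card (points_in \<C> (orth w))))
      = (\<Sum>w\<in>B. int (card (points_in \<C> (orth w)))) + int M"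
    by (simp flip: of_nat_sum of_nat_add)
  \<comment> \<open>Neither \<open>A\<close> nor \<open>B\<close> contains 0, since each prescribes
    the value 1 somewhere.\<close>
  moreover have "[(\<Sum>w\<in>A. int (card (points_in \<C> (orth w)))) = int M * u] (mod int \<Delta>)"
    "[(\<Sum>w\<in>B. int (card (points_in \<C> (orth w)))) = int M * u] (mod int \<Delta>)"
    using cong_sum_card_points_in_orth [OF u, of A] cong_sum_card_points_in_orth [OF u, of B]
    by (simp_all add: card_A card_B) (simp_all add: A_def B_def)
  ultimately have "int \<Delta> dvd int M"
    by (smt (verit) cong_iff_dvd_diff dvd_diff)
  then have "\<Delta> dvd M" by (simp only: int_dvd_int_iff)
  then show "\<Delta> dvd CARD('a) ^ (CARD('v) - 2)" by (simp only: M_def)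
qed

lemma weakly_divisible_imp_strongly_divisible:
  fixes \<C> :: "('a::{finite,field} ^ 'v) set set"
  assumes sub: "\<C> \<subseteq> pg_points" and "\<C> \<noteq> {}" "\<C> \<noteq> pg_points"
    and "weakly_divisible \<Delta> \<C>"
  shows "strongly_divisible \<Delta> \<C>"
proof -
  obtain u where u: "\<forall>H\<in>pg_hyperplanes. [int (card (points_in \<C> H)) = u] (mod int \<Delta>)"
    using assms(4) by (auto simp: weakly_divisible_def)
  note dvd = weakly_divisible_dvd_power [OF assms]
  define Q where "Q = CARD('a) ^ (CARD('v) - 1)"
  have q_Q: "CARD('a) ^ CARD('v) = Q * CARD('a)"
    unfolding Q_def by (rule power_minus_mult [symmetric]) simp
  have "\<Delta> dvd Q"
    unfolding Q_def by (rule dvd_trans [OF dvd le_imp_power_dvd]) simp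
  have card_orth: "card {w. P \<subseteq> orth w} = Q" if "P \<in> \<C>" for P
  proof -
    have "P \<in> pg_points" using that sub by blast
    then obtain x where x: "x \<noteq> 0" "P = vec.span {x}" by (rule pg_pointsE)
    have "card {w. dot w x = 0} * CARD('a) = Q * CARD('a)"
      using card_dot_eq_on_independent [of "{x}" "\<lambda>_. 0"] x(1) by (simp add: q_Q)
    then show ?thesis by (simp add: x(2) span_singleton_subset_orth_iff)
  qed
  let ?a = "\<lambda>w. int (card (points_in \<C> (orth w)))"
  have at_0: "?a 0 = int (card \<C>)" by (simp add: points_in_def orth_def)
  have card_nz: "int (card (UNIV - {0 :: 'a ^ 'v})) = int (Q * CARD('a)) - 1"
    by (simp add: card_Diff_singleton Suc_leI flip: q_Q)
  have "int (card \<C> * Q) = int (\<Sum>w\<in>UNIV. card (points_in \<C> (orth w)))"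
    unfolding sum_card_points_in_orth by (simp add: card_orth)
  also have "\<dots> = int (card \<C>) + (\<Sum>w\<in>UNIV - {0}. ?a w)"
    by (simp add: sum.remove [of UNIV 0] at_0)
  finally have total: "(\<Sum>w\<in>UNIV - {0}. ?a w) = int (card \<C> * Q) - int (card \<C>)" by simp
  have "[int (card \<C> * Q) - int (card \<C>) = (int (Q * CARD('a)) - 1) * u] (mod int \<Delta>)"
    using cong_sum_card_points_in_orth [OF u, of "UNIV - {0}"] unfolding total card_nz by simp
  \<comment> \<open>Regrouping isolates the multiples of \<open>Q\<close>, which vanish modulo
    \<open>\<Delta>\<close>; only \<open>u\<close> minus the number of points remains.\<close>
  then have "int \<Delta> dvd int Q * (int (card \<C>) - int CARD('a) * u) + (u - int (card \<C>))"
    by (simp add: cong_iff_dvd_diff algebra_simps)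
  moreover have "int \<Delta> dvd int Q * (int (card \<C>) - int CARD('a) * u)"
    using \<open>\<Delta> dvd Q\<close> by simp
  ultimately have "[u = int (card \<C>)] (mod int \<Delta>)"
    by (simp add: cong_iff_dvd_diff dvd_add_right_iff)
  with u show ?thesis
    unfolding strongly_divisible_def by (blast intro: cong_trans)
qed

section \<open>Codewords and their Hamming weights\<close>

lemma row_codeE:
  fixes G :: "'a::{finite,field} ^ 'n ^ 'v"
  assumes "c \<in> row_code G"
  obtains w where "\<And>j. c $ j = dot w (column j G)"
proof -
  \<comment> \<open>The words of this form are a subspace containing every row, obtained from unit
    vectors \<open>w\<close>; so they include the whole row span.\<close>
  let ?S = "{c. \<exists>w. \<forall>j. c $ j = dot w (column j G)}"
  have "vec.subspace ?S"
    unfolding vec.subspace_def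
  proof (intro conjI ballI allI)
    show "0 \<in> ?S" by (auto intro: exI [of _ 0])
  next
    fix x y assume "x \<in> ?S" "y \<in> ?S"
    then obtain w z where "\<forall>j. x $ j = dot w (column j G)" "\<forall>j. y $ j = dot z (column j G)"
      by blast
    then have "\<forall>j. (x + y) $ j = dot (w + z) (column j G)" by (simp add: dot_add_left)
    then show "x + y \<in> ?S" by blast
  next
    fix k x assume "x \<in> ?S"
    then obtain w where "\<forall>j. x $ j = dot w (column j G)" by blast
    then have "\<forall>j. (k *s x) $ j = dot (k *s w) (column j G)" by (simp add: dot_scale_left)
    then show "k *s x \<in> ?S" by blast
  qed
  moreover have "rows G \<subseteq> ?S"
  proof
    fix c assume "c \<in> rows G"
    then obtain i where "c = row i G" by (auto simp: rows_def)
    then have "\<forall>j. c $ j = dot (axis i 1) (column j G)" by (simp add: row_def column_def)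
    then show "c \<in> ?S" by blast
  qed
  ultimately have "row_code G \<subseteq> ?S"
    unfolding row_code_def by (intro vec.span_minimal)
  with assms that show ?thesis by blast
qed

lemma strongly_divisible_dvd_hamming_weight:
  fixes G :: "'a::{finite,field} ^ 'n ^ 'v"
  assumes div: "strongly_divisible \<Delta> \<C>" and rep: "represents_points G \<C>"
    and c: "c \<in> row_code G" "c \<noteq> 0"
  shows "\<Delta> dvd hamming_weight c"
proof -
  obtain w where w: "\<And>j. c $ j = dot w (column j G)" using c(1) by (rule row_codeE) blast
  \<comment> \<open>This makes \<open>orth w\<close> a hyperplane, so that strong divisibility
    applies to it.\<close>
  have "w \<noteq> 0"
  proof
    assume "w = 0"
    with w have "\<And>j. c $ j = 0" by (simp only: dot_zero_left)
    then have "c = 0" by (simp add: vec_eq_iff)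
    with c(2) show False ..
  qed
  then have "[int (card (points_in \<C> (orth w))) = int (card \<C>)] (mod int \<Delta>)"
    using div orth_in_pg_hyperplanes by (auto simp: strongly_divisible_def)
  moreover have "card \<C> = hamming_weight c + card (points_in \<C> (orth w))"
  proof -
    let ?f = "\<lambda>j. vec.span {column j G}"
    have f: "inj ?f" "range ?f = \<C>"
      using rep by (auto simp: represents_points_def bij_betw_def)
    have "?f j \<subseteq> orth w \<longleftrightarrow> c $ j = 0" for j
      by (simp only: span_singleton_subset_orth_iff w)
    \<comment> \<open>Columns correspond bijectively to points, so counting points in the hyperplane
      amounts to counting zero coordinates of \<open>c\<close>.\<close>
    then have "points_in \<C> (orth w) = ?f ` {j. c $ j = 0}"
      unfolding points_in_def f(2) [symmetric] by blast
    then have "card (points_in \<C> (orth w)) = card {j. c $ j = 0}"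
      using f(1) by (simp add: card_image inj_on_subset)
    moreover have "card \<C> = CARD('n)"
      using card_image [OF f(1)] f(2) by simp
    moreover have "CARD('n) = card {j. c $ j \<noteq> 0} + card {j. c $ j = 0}"
      by (subst card_Un_disjoint [symmetric]) (auto intro: arg_cong [where f = card])
    ultimately show ?thesis by (simp add: hamming_weight_def)
  qed
  ultimately show ?thesis
    by (simp add: cong_iff_dvd_diff)
qed

theorem theorem7:
  fixes \<C> :: "('a::{finite,field} ^ 'v) set set"
    and \<Delta> :: nat
  assumes "\<Delta> > 1"
    and "\<C> \<subseteq> pg_points"
    and "\<C> \<noteq> {}"
    and "\<C> \<noteq> pg_points"
    and "weakly_divisible \<Delta> \<C>"
  shows "strongly_divisible \<Delta> \<C>
    \<and> (\<forall>G :: 'a ^ 'n ^ 'v. CARD('n) = card \<C> \<and> represents_points G \<C> \<longrightarrow>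
         (\<forall>c\<in>row_code G. c \<noteq> 0 \<longrightarrow> \<Delta> dvd hamming_weight c))
    \<and> \<Delta> dvd CARD('a) ^ (CARD('v) - 2)"
  using weakly_divisible_imp_strongly_divisible [OF assms(2-5)]
    weakly_divisible_dvd_power [OF assms(2-5)] strongly_divisible_dvd_hamming_weight
  by blast

end
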